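(* Let $D$ be a $\mathbb K$-module. A matching dendriform algebra structure on $D$ is equivalent to a multiplication on the nonsymmetric operad $\mathcal O_D$.
   Context: $\mathbb K$ is a commutative unital ring with $\mathrm{char}\,\mathbb K\neq 2$; all modules, linear maps, Hom spaces and tensor products are over $\mathbb K$; $X$ is a nonempty set. A matching dendriform algebra structure on $D$ is a collection of linear maps $\prec_x,\succ_x:D\otimes D\to D$ $(x\in X)$ such that for all $a,b,c\in D$, $x,y\in X$: $(a\prec_xb)\prec_yc=a\prec_x(b\prec_yc)+a\prec_y(b\succ_xc)$; $(a\succ_xb)\prec_yc=a\succ_x(b\prec_yc)$; $(a\prec_yb)\succ_xc+(a\succ_xb)\succ_yc=a\succ_x(b\succ_yc)$. The nonsymmetric operad $\mathcal O_D=(\{\mathcal O_D(k)\}_{k\ge1},\circ_i)$: let $C_k=\{[1],\dots,[k]\}$ and let $\mathbb K[C_k]$ be the free $\mathbb K$-module on $C_k$. $\mathcal O_D(k)$ is the $\mathbb K$-module of all families $f=\oplus_{x_1,\dots,x_k\in X}f_{x_1,\dots,x_k}$ (indexed by $X^{\times k}$) with $f_{x_1,\dots,x_k}\in\mathrm{Hom}(\mathbb K[C_k]\otimes D^{\otimes k},D)$ such that, writing $f^{[r]}_{x_1,\dots,x_k}=f_{x_1,\dots,x_k}([r];-,\dots,-):D^{\otimes k}\to D$, the map $f^{[r]}_{x_1,\dots,x_k}$ does not depend on $x_r$, for each $1\le r\le k$. For $f\in\mathcal O_D(k)$, $g\in\mathcal O_D(l)$, $1\le i\le k$, the partial composition $f\circ_ig\in\mathcal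 O_D(k+l-1)$ is given by $(f\circ_ig)^{[r]}_{x_1,\dots,x_{k+l-1}}(a_1,\dots,a_{k+l-1})=$ - if $1\le r\le i-1$: $\sum_{s=1}^lf^{[r]}_{x_1,\dots,x_{i-1},x_{i-1+s},x_{i+l},\dots,x_{k+l-1}}(a_1,\dots,a_{i-1},g^{[s]}_{x_i,\dots,x_{i+l-1}}(a_i,\dots,a_{i+l-1}),a_{i+l},\dots,a_{k+l-1})$; - if $i\le r\le i+l-1$: $f^{[i]}_{x_1,\dots,x_{i-1},x_r,x_{i+l},\dots,x_{k+l-1}}(a_1,\dots,a_{i-1},g^{[r-i+1]}_{x_i,\dots,x_{i+l-1}}(a_i,\dots,a_{i+l-1}),a_{i+l},\dots,a_{k+l-1})$; - if $i+l\le r\le k+l-1$: $\sum_{s=1}^lf^{[r-l+1]}_{x_1,\dots,x_{i-1},x_{i-1+s},x_{i+l},\dots,x_{k+l-1}}(a_1,\dots,a_{i-1},g^{[s]}_{x_i,\dots,x_{i+l-1}}(a_i,\dots,a_{i+l-1}),a_{i+l},\dots,a_{k+l-1})$. A multiplication on a nonsymmetric operad $\mathcal O=(\{\mathcal O(k)\}_{k\ge1},\circ_i)$ is an element $\pi\in\mathcal O(2)$ with $\pi\circ_1\pi=\pi\circ_2\pi$. *)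

theory Defs
  imports Complex_Main "HOL-Library.Poly_Mapping"
begin

text \<open>
  Conventions. The module \<open>D\<close> is the type \<open>'d\<close> with the scalar multiplication \<open>scale\<close>
  (locale \<^locale>\<open>module\<close>); the nonempty index set \<open>X\<close> is the type \<open>'x\<close>. A linear map out of a
  tensor product is represented by the corresponding multilinear map. The
  basis elements \<open>[r]\<close> and the position \<open>i\<close> in \<open>\<circ>\<^sub>i\<close> are numbered from 1; since list positions are
  numbered from 0, \<open>x\<^sub>r\<close> is \<open>xs ! (r - 1)\<close>.
\<close>

section \<open>Matching dendriform algebras\<close>

definition bilinear_op ::
    "('k::comm_ring_1 \<Rightarrow> 'd::ab_group_add \<Rightarrow> 'd) \<Rightarrow> ('d \<Rightarrow> 'd \<Rightarrow> 'd) \<Rightarrow> bool" where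
  "bilinear_op scale m \<longleftrightarrow>
     (\<forall>b. module_hom scale scale (\<lambda>a. m a b)) \<and> (\<forall>a. module_hom scale scale (\<lambda>b. m a b))"

definition matching_dendriform ::
    "('k::comm_ring_1 \<Rightarrow> 'd::ab_group_add \<Rightarrow> 'd) \<Rightarrow>
     ('x \<Rightarrow> 'd \<Rightarrow> 'd \<Rightarrow> 'd) \<Rightarrow> ('x \<Rightarrow> 'd \<Rightarrow> 'd \<Rightarrow> 'd) \<Rightarrow> bool" where
  "matching_dendriform scale prec succ \<longleftrightarrow>
     (\<forall>x. bilinear_op scale (prec x)) \<and> (\<forall>x. bilinear_op scale (succ x)) \<and>
     (\<forall>a b c x y.
        prec y (prec x a b) c = prec x a (prec y b c) + prec y a (succ x b c) \<and>
        prec y (succ x a b) c = succ x a (prec y b c) \<and>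
        succ x (prec y a b) c + succ y (succ x a b) c = succ x a (succ y b c))"

section \<open>Multiplications on nonsymmetric operads\<close>

text \<open>
  An operad enters through its components \<open>P k\<close> (only \<open>k \<ge> 1\<close> matters) and its partial
  compositions: \<open>circ k l i f g\<close> is \<open>f \<circ>\<^sub>i g\<close> for \<open>f\<close> of arity \<open>k\<close> and \<open>g\<close> of arity \<open>l\<close>.
\<close>

definition operad_multiplication ::
    "(nat \<Rightarrow> 'p set) \<Rightarrow> (nat \<Rightarrow> nat \<Rightarrow> nat \<Rightarrow> 'p \<Rightarrow> 'p \<Rightarrow> 'p) \<Rightarrow> 'p \<Rightarrow> bool" where
  "operad_multiplication P circ \<pi> \<longleftrightarrow> \<pi> \<in> P 2 \<and> circ 2 2 1 \<pi> \<pi> = circ 2 2 2 \<pi> \<pi>"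

section \<open>The operad \<open>O\<^sub>D\<close>\<close>

text \<open>
  The free module \<open>K[C\<^sub>k]\<close> consists of the \<open>c :: nat \<Rightarrow>\<^sub>0 'k\<close> with support in \<open>{1..k}\<close>; the basis
  element \<open>[r]\<close> is \<open>single r 1\<close>, and \<open>Poly_Mapping.map ((*) s) c\<close> is the scalar multiple \<open>s c\<close>.
\<close>

definition free_module_C :: "nat \<Rightarrow> (nat \<Rightarrow>\<^sub>0 'k::comm_ring_1) set" where
  "free_module_C k = {c. Poly_Mapping.keys c \<subseteq> {1..k}}"

definition basis_C :: "nat \<Rightarrow> (nat \<Rightarrow>\<^sub>0 'k::comm_ring_1)" where
  "basis_C r = Poly_Mapping.single r 1"

text \<open>\<open>Hom (K[C\<^sub>k] \<otimes> D\<^bsup>\<otimes>k\<^esup>, D)\<close>, as multilinear maps extended by 0 outside of their domain so that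
  equality of maps is equality of functions.\<close>

definition hom_C ::
    "('k::comm_ring_1 \<Rightarrow> 'd::ab_group_add \<Rightarrow> 'd) \<Rightarrow> nat \<Rightarrow>
     ((nat \<Rightarrow>\<^sub>0 'k) \<Rightarrow> 'd list \<Rightarrow> 'd) set" where
  "hom_C scale k = {h.
     (\<forall>c as. c \<notin> free_module_C k \<or> length as \<noteq> k \<longrightarrow> h c as = 0) \<and>
     (\<forall>as. length as = k \<longrightarrow>
        (\<forall>c \<in> free_module_C k. \<forall>c' \<in> free_module_C k. h (c + c') as = h c as + h c' as) \<and>
        (\<forall>s. \<forall>c \<in> free_module_C k. h (Poly_Mapping.map ((*) s) c) as = scale s (h c as))) \<and>
     (\<forall>c \<in> free_module_C k. \<forall>as j. length as = k \<and> j < k \<longrightarrow>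
        module_hom scale scale (\<lambda>a. h c (as[j := a])))}"

text \<open>A family \<open>f\<close> is a function of \<open>x\<^sub>1, \<dots>, x\<^sub>k\<close> with values in \<^const>\<open>hom_C\<close>, again extended by 0.\<close>

type_synonym ('x, 'k, 'd) family = "'x list \<Rightarrow> (nat \<Rightarrow>\<^sub>0 'k) \<Rightarrow> 'd list \<Rightarrow> 'd"

definition component ::
    "('x, 'k::comm_ring_1, 'd) family \<Rightarrow> nat \<Rightarrow> 'x list \<Rightarrow> 'd list \<Rightarrow> 'd" where
  "component f r xs as = f xs (basis_C r) as"

definition O_D ::
    "('k::comm_ring_1 \<Rightarrow> 'd::ab_group_add \<Rightarrow> 'd) \<Rightarrow> nat \<Rightarrow> ('x, 'k, 'd) family set" where
  "O_D scale k = {f.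
     (\<forall>xs. length xs = k \<longrightarrow> f xs \<in> hom_C scale k) \<and>
     (\<forall>xs. length xs \<noteq> k \<longrightarrow> f xs = (\<lambda>c as. 0)) \<and>
     (\<forall>r \<in> {1..k}. \<forall>xs y. length xs = k \<longrightarrow>
        component f r (xs[r - 1 := y]) = component f r xs)}"

text \<open>For \<open>zs = [z\<^sub>1, \<dots>, z\<^sub>n]\<close>: the block \<open>[z\<^sub>i, \<dots>, z\<^bsub>i+l-1\<^esub>]\<close>, and
  \<open>[z\<^sub>1, \<dots>, z\<^bsub>i-1\<^esub>, w, z\<^bsub>i+l\<^esub>, \<dots>, z\<^sub>n]\<close>, in which \<open>w\<close> replaces that block.\<close>

definition block :: "nat \<Rightarrow> nat \<Rightarrow> 'a list \<Rightarrow> 'a list" where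
  "block i l zs = take l (drop (i - 1) zs)"

definition replace_block :: "nat \<Rightarrow> nat \<Rightarrow> 'a \<Rightarrow> 'a list \<Rightarrow> 'a list" where
  "replace_block i l w zs = take (i - 1) zs @ [w] @ drop (i - 1 + l) zs"

definition comp_component ::
    "nat \<Rightarrow> nat \<Rightarrow> nat \<Rightarrow> ('x, 'k::comm_ring_1, 'd::ab_group_add) family \<Rightarrow> ('x, 'k, 'd) family \<Rightarrow>
     nat \<Rightarrow> 'x list \<Rightarrow> 'd list \<Rightarrow> 'd" where
  "comp_component k l i f g r xs as =
     (if r < i then
        (\<Sum>s = 1..l. component f r (replace_block i l (xs ! (i - 1 + s - 1)) xs)
           (replace_block i l (component g s (block i l xs) (block i l as)) as))
      else if r \<le> i + l - 1 then
        component f i (replace_block i l (xs ! (r - 1)) xs)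
          (replace_block i l (component g (r - i + 1) (block i l xs) (block i l as)) as)
      else
        (\<Sum>s = 1..l. component f (r - l + 1) (replace_block i l (xs ! (i - 1 + s - 1)) xs)
           (replace_block i l (component g s (block i l xs) (block i l as)) as)))"

text \<open>\<open>f \<circ>\<^sub>i g\<close> is the linear extension to \<open>K[C\<^bsub>k+l-1\<^esub>]\<close> of the components just defined.\<close>

definition O_D_comp ::
    "('k::comm_ring_1 \<Rightarrow> 'd::ab_group_add \<Rightarrow> 'd) \<Rightarrow> nat \<Rightarrow> nat \<Rightarrow> nat \<Rightarrow>
     ('x, 'k, 'd) family \<Rightarrow> ('x, 'k, 'd) family \<Rightarrow> ('x, 'k, 'd) family" where
  "O_D_comp scale k l i f g = (\<lambda>xs c as.
     if length xs = k + l - 1 \<and> c \<in> free_module_C (k + l - 1) \<and> length as = k + l - 1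
     then \<Sum>r = 1..k + l - 1.
            scale (Poly_Mapping.lookup c r) (comp_component k l i f g r xs as)
     else 0)"

section \<open>The correspondence\<close>

text \<open>The family \<open>\<pi>\<close> with \<open>\<pi>\<^bsup>[1]\<^esup>\<^bsub>x,y\<^esub>(a, b) = a \<prec>\<^sub>y b\<close> and \<open>\<pi>\<^bsup>[2]\<^esup>\<^bsub>x,y\<^esub>(a, b) = a \<succ>\<^sub>x b\<close>.\<close>

definition dendriform_family ::
    "('k::comm_ring_1 \<Rightarrow> 'd::ab_group_add \<Rightarrow> 'd) \<Rightarrow>
     ('x \<Rightarrow> 'd \<Rightarrow> 'd \<Rightarrow> 'd) \<times> ('x \<Rightarrow> 'd \<Rightarrow> 'd \<Rightarrow> 'd) \<Rightarrow> ('x, 'k, 'd) family" where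
  "dendriform_family scale = (\<lambda>(prec, succ) xs c as.
     if length xs = 2 \<and> c \<in> free_module_C 2 \<and> length as = 2
     then scale (Poly_Mapping.lookup c 1) (prec (xs ! 1) (as ! 0) (as ! 1)) +
          scale (Poly_Mapping.lookup c 2) (succ (xs ! 0) (as ! 0) (as ! 1))
     else 0)"

end

theory Submission
  imports Defs
begin

text \<open>
  Each component \<open>\<pi>\<^bsup>[r]\<^esup>\<close> of an element of \<open>O\<^sub>D(2)\<close> ignores \<open>x\<^sub>r\<close>, so it is a family of
  bilinear maps indexed by the single remaining label: \<open>\<pi>\<^bsup>[1]\<^esup>\<close> depends on \<open>x\<^sub>2\<close> only and gives the
  operations \<open>\<prec>\<close>, while \<open>\<pi>\<^bsup>[2]\<^esup>\<close> depends on \<open>x\<^sub>1\<close> only and gives the operations \<open>\<succ>\<close>. Linearity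
  in \<open>K[C\<^sub>2]\<close> recovers \<open>\<pi>\<close> from these two components. Hence pairs of families of bilinear operations
  correspond bijectively to elements of \<open>O\<^sub>D(2)\<close> (\<open>dendriform_family_in_O_D\<close> and
  \<open>O_D_2_eq_dendriform_family\<close>; injectivity is evaluation at \<open>[1]\<close> and \<open>[2]\<close>).

  It remains to match the equations. An equality of partial compositions in arity 3 can be tested on
  the basis elements \<open>[1]\<close>, \<open>[2]\<close>, \<open>[3]\<close> (\<open>O_D_comp_eq_iff\<close>), and the component of
  \<open>\<pi> \<circ>\<^sub>1 \<pi> = \<pi> \<circ>\<^sub>2 \<pi>\<close> at \<open>[r]\<close> is precisely the \<open>r\<close>-th matching dendriform axiom
  (\<open>dendriform_family_associative_iff\<close>).
\<close>

section \<open>Free modules and compositions on basis elements\<close>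

lemma basis_C_in_free_module [simp]: "r \<in> {1..k} \<Longrightarrow> basis_C r \<in> free_module_C k"
  by (simp add: basis_C_def free_module_C_def)

lemma lookup_basis_C: "Poly_Mapping.lookup (basis_C r) s = (if r = s then 1 else 0)"
  by (simp add: basis_C_def lookup_single when_def)

lemma lookup_scalar_multiple [simp]:
  "Poly_Mapping.lookup (Poly_Mapping.map ((*) (s :: 'k::comm_ring_1)) c) r = s * Poly_Mapping.lookup c r"
  by (simp add: map.rep_eq when_def)

lemma free_module_C_add:
  "c \<in> free_module_C k \<Longrightarrow> c' \<in> free_module_C k \<Longrightarrow> c + c' \<in> free_module_C k"
  using keys_add[of c c'] by (auto simp: free_module_C_def)

lemma free_module_C_scalar_multiple:
  "c \<in> free_module_C k \<Longrightarrow> Poly_Mapping.map ((*) (s :: 'k::comm_ring_1)) c \<in> free_module_C k"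
  unfolding free_module_C_def in_keys_iff subset_iff mem_Collect_eq lookup_scalar_multiple
  by (metis mult_zero_right)

lemma free_module_C_2_expand:
  fixes c :: "nat \<Rightarrow>\<^sub>0 'k::comm_ring_1"
  assumes "c \<in> free_module_C 2"
  shows "c = Poly_Mapping.map ((*) (Poly_Mapping.lookup c 1)) (basis_C 1) +
             Poly_Mapping.map ((*) (Poly_Mapping.lookup c 2)) (basis_C 2)"
proof (rule poly_mapping_eqI)
  fix r
  have "Poly_Mapping.lookup c r = 0" if "r \<noteq> 1" "r \<noteq> 2"
  proof -
    have "r \<notin> {1..2}"
      using that by auto
    then show ?thesis
      using assms by (auto simp: free_module_C_def in_keys_iff subset_iff)
  qed
  then show "Poly_Mapping.lookup c r = Poly_Mapping.lookup
      (Poly_Mapping.map ((*) (Poly_Mapping.lookup c 1)) (basis_C 1) +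
       Poly_Mapping.map ((*) (Poly_Mapping.lookup c 2)) (basis_C 2)) r"
    by (auto simp: lookup_add lookup_basis_C)
qed

lemma component_O_D_comp:
  assumes "module scale" "r \<in> {1..k + l - 1}" "length xs = k + l - 1" "length as = k + l - 1"
  shows "component (O_D_comp scale k l i f g) r xs as = comp_component k l i f g r xs as"
proof -
  interpret module scale by fact
  have "component (O_D_comp scale k l i f g) r xs as =
    (\<Sum>q = 1..k + l - 1. if q = r then comp_component k l i f g q xs as else 0)"
    using assms(2-) unfolding component_def O_D_comp_def
    by (auto simp del: sum.delta sum.delta' simp: lookup_basis_C intro!: sum.cong)
  also have "\<dots> = comp_component k l i f g r xs as"
    using assms(2) by simp
  finally show ?thesis .
qed

lemma O_D_comp_eq_iff:
  assumes "module scale"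
  shows "O_D_comp scale k l i f g = O_D_comp scale k l j f' g' \<longleftrightarrow>
    (\<forall>r \<in> {1..k + l - 1}. \<forall>xs as. length xs = k + l - 1 \<and> length as = k + l - 1 \<longrightarrow>
       comp_component k l i f g r xs as = comp_component k l j f' g' r xs as)"
    (is "?L \<longleftrightarrow> ?R")
proof
  assume ?L
  then show ?R
    using component_O_D_comp[OF assms, of _ k l] by metis
next
  assume ?R
  then show ?L
    by (auto simp: O_D_comp_def fun_eq_iff intro!: sum.cong)
qed

section \<open>Elements of arity two\<close>

lemma component_dendriform_family:
  assumes "module scale"
  shows "component (dendriform_family scale (prec, succ)) 1 [x, y] [a, b] = prec y a b"
    and "component (dendriform_family scale (prec, succ)) 2 [x, y] [a, b] = succ x a b"
proof -
  interpret module scale by fact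
  show "component (dendriform_family scale (prec, succ)) 1 [x, y] [a, b] = prec y a b"
    and "component (dendriform_family scale (prec, succ)) 2 [x, y] [a, b] = succ x a b"
    by (simp_all add: component_def dendriform_family_def lookup_basis_C)
qed

lemma dendriform_family_in_O_D:
  fixes scale :: "'k::comm_ring_1 \<Rightarrow> 'd::ab_group_add \<Rightarrow> 'd"
  assumes "module scale" "\<And>x. bilinear_op scale (prec x)" "\<And>x. bilinear_op scale (succ x)"
  shows "dendriform_family scale (prec, succ) \<in> O_D scale 2"
proof -
  interpret module scale by fact
  let ?F = "dendriform_family scale (prec, succ)"
  have lin: "prec x (a + a') b = prec x a b + prec x a' b" "prec x a (b + b') = prec x a b + prec x a b'"
    "prec x (scale s a) b = scale s (prec x a b)" "prec x a (scale s b) = scale s (prec x a b)"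
    "succ x (a + a') b = succ x a b + succ x a' b" "succ x a (b + b') = succ x a b + succ x a b'"
    "succ x (scale s a) b = scale s (succ x a b)" "succ x a (scale s b) = scale s (succ x a b)"
    for x a a' b b' s
    using assms(2,3)[of x] by (auto simp: bilinear_op_def module_hom_iff)
  have hom: "?F xs \<in> hom_C scale 2" if len: "length xs = 2" for xs
  proof -
    have "module_hom scale scale (\<lambda>a. ?F xs c (as[j := a]))"
      if c: "c \<in> free_module_C 2" and as: "length as = 2" and j: "j < 2" for c as j
    proof -
      obtain a b where ab: "as = [a, b]"
        using as by (auto simp: numeral_2_eq_2 length_Suc_conv)
      consider "j = 0" | "j = 1"
        using j by linarith
      then show ?thesis
        by cases (simp_all add: ab module_hom_iff module_axioms dendriform_family_def c len lin
            scale_right_distrib mult.commute)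
    qed
    then show ?thesis
      using len
      by (auto simp: hom_C_def dendriform_family_def free_module_C_add free_module_C_scalar_multiple
          lookup_add scale_left_distrib scale_right_distrib)
  qed
  moreover have "component ?F r (xs[r - 1 := y]) = component ?F r xs"
    if "r \<in> {1..2}" "length xs = 2" for r xs y
  proof -
    have "r = 1 \<or> r = 2"
      using that(1) by auto
    then show ?thesis
      using that(2) by (auto simp: component_def dendriform_family_def lookup_basis_C fun_eq_iff)
  qed
  ultimately show ?thesis
    by (auto simp: O_D_def dendriform_family_def fun_eq_iff)
qed

text \<open>The invariance conditions allow an arbitrary label to be put at the position that the
  respective component ignores; \<open>undefined\<close> serves as that label.\<close>

lemma O_D_2_eq_dendriform_family:
  fixes scale :: "'k::comm_ring_1 \<Rightarrow> 'd::ab_group_add \<Rightarrow> 'd" and \<pi> :: "('x, 'k, 'd) family"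
  assumes "module scale" "\<pi> \<in> O_D scale 2"
  obtains prec succ where "\<And>x. bilinear_op scale (prec x)" "\<And>x. bilinear_op scale (succ x)"
    "\<pi> = dendriform_family scale (prec, succ)"
proof -
  interpret module scale by fact
  define prec where "prec y a b = component \<pi> 1 [undefined, y] [a, b]" for y a b
  define succ where "succ x a b = component \<pi> 2 [x, undefined] [a, b]" for x a b
  have hom: "\<pi> xs \<in> hom_C scale 2" if "length xs = 2" for xs
    using assms(2) that by (simp add: O_D_def)
  have bilinear: "bilinear_op scale (\<lambda>a b. component \<pi> r xs [a, b])"
    if r: "r \<in> {1..2}" and xs: "length xs = 2" for r xs
  proof -
    have upd: "module_hom scale scale (\<lambda>a. \<pi> xs (basis_C r) (as[j := a]))"
      if "length as = 2" "j < 2" for as j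
      using hom[OF xs] basis_C_in_free_module[OF r] that unfolding hom_C_def by blast
    show ?thesis
      unfolding bilinear_op_def component_def
      using upd[of "[_, _]" 0] upd[of "[_, _]" 1] by simp
  qed
  have "bilinear_op scale (prec x)" "bilinear_op scale (succ x)" for x
    using bilinear[of 1 "[undefined, x]"] bilinear[of 2 "[x, undefined]"]
    by (simp_all add: prec_def[abs_def] succ_def[abs_def])
  moreover have "\<pi> = dendriform_family scale (prec, succ)"
  proof (intro ext)
    fix xs c as
    show "\<pi> xs c as = dendriform_family scale (prec, succ) xs c as"
    proof (cases "length xs = 2 \<and> c \<in> free_module_C 2 \<and> length as = 2")
      case False
      have "\<pi> xs c as = 0"
      proof (cases "length xs = 2")
        case True
        then show ?thesis
          using hom[OF True] False by (auto simp: hom_C_def)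
      next
        case False
        then show ?thesis
          using assms(2) by (simp add: O_D_def)
      qed
      then show ?thesis
        using False by (auto simp: dendriform_family_def)
    next
      case True
      then obtain x y a b where xs: "xs = [x, y]" and as: "as = [a, b]"
        by (auto simp: numeral_2_eq_2 length_Suc_conv)
      let ?c = "\<lambda>r. Poly_Mapping.map ((*) (Poly_Mapping.lookup c r)) (basis_C r)"
      have h: "\<pi> xs \<in> hom_C scale 2"
        using hom True by simp
      have mem: "?c 1 \<in> free_module_C 2" "?c 2 \<in> free_module_C 2"
        by (simp_all add: free_module_C_scalar_multiple)
      have "\<pi> xs c as = \<pi> xs (?c 1 + ?c 2) as"
        using free_module_C_2_expand True by metis
      also have "\<dots> = \<pi> xs (?c 1) as + \<pi> xs (?c 2) as"
        using h mem True by (simp add: hom_C_def)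
      also have "\<dots> = scale (Poly_Mapping.lookup c 1) (component \<pi> 1 xs as) +
          scale (Poly_Mapping.lookup c 2) (component \<pi> 2 xs as)"
        using h True by (simp add: hom_C_def component_def)
      also have "component \<pi> 1 xs as = prec y a b"
      proof -
        have "component \<pi> 1 (xs[1 - 1 := undefined]) = component \<pi> 1 xs"
          using assms(2) True unfolding O_D_def by fastforce
        then show ?thesis
          by (simp add: prec_def xs as)
      qed
      also have "component \<pi> 2 xs as = succ x a b"
      proof -
        have "component \<pi> 2 (xs[2 - 1 := undefined]) = component \<pi> 2 xs"
          using assms(2) True unfolding O_D_def by fastforce
        then show ?thesis
          by (simp add: succ_def xs as)
      qed
      finally show ?thesis
        using True by (simp add: dendriform_family_def xs as)
    qed
  qed
  ultimately show thesis
    by (rule that)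
qed

section \<open>Associativity and the dendriform axioms\<close>

text \<open>At the basis element \<open>[r]\<close> the label \<open>x\<^sub>r\<close> occurs on neither side, so the equation of arity 3
  involves only two labels. The pair \<open>(x, y)\<close> of the axioms is \<open>(x\<^sub>2, x\<^sub>3)\<close>, \<open>(x\<^sub>1, x\<^sub>3)\<close> and
  \<open>(x\<^sub>1, x\<^sub>2)\<close> for \<open>r = 1, 2, 3\<close>; the sums of two products come from the sum over \<open>s\<close> in the
  partial composition, which appears when \<open>r\<close> lies outside the inserted block.\<close>

lemma dendriform_family_associative_iff:
  fixes scale :: "'k::comm_ring_1 \<Rightarrow> 'd::ab_group_add \<Rightarrow> 'd"
    and prec succ :: "'x \<Rightarrow> 'd \<Rightarrow> 'd \<Rightarrow> 'd"
  assumes "module scale"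
  defines "F \<equiv> dendriform_family scale (prec, succ)"
  shows "O_D_comp scale 2 2 1 F F = O_D_comp scale 2 2 2 F F \<longleftrightarrow>
    (\<forall>a b c x y.
        prec y (prec x a b) c = prec x a (prec y b c) + prec y a (succ x b c) \<and>
        prec y (succ x a b) c = succ x a (prec y b c) \<and>
        succ x (prec y a b) c + succ y (succ x a b) c = succ x a (succ y b c))"
proof -
  have F1: "component F 1 [x, y] [a, b] = prec y a b"
    and F2: "component F 2 [x, y] [a, b] = succ x a b" for x y a b
    unfolding F_def by (rule component_dendriform_family[OF assms(1)])+
  have all3: "(\<forall>zs. length zs = 3 \<longrightarrow> P zs) \<longleftrightarrow> (\<forall>x y z. P [x, y, z])" for P :: "'z list \<Rightarrow> bool"
    by (auto simp: numeral_3_eq_3 length_Suc_conv)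
  have "{1..2} = {1, 2 :: nat}"
    by auto
  note comp_simps = comp_component_def block_def replace_block_def this
    this[unfolded One_nat_def] F1 F2 F1[unfolded One_nat_def] F2[unfolded numeral_2_eq_2]
  have left: "comp_component 2 2 1 F F 1 [x, y, z] [a, b, c] = prec z (prec y a b) c"
    "comp_component 2 2 1 F F 2 [x, y, z] [a, b, c] = prec z (succ x a b) c"
    "comp_component 2 2 1 F F 3 [x, y, z] [a, b, c] =
       succ x (prec y a b) c + succ y (succ x a b) c" for x y z a b c
    by (simp_all add: comp_simps)
  have right: "comp_component 2 2 2 F F 1 [x, y, z] [a, b, c] =
       prec y a (prec z b c) + prec z a (succ y b c)"
    "comp_component 2 2 2 F F 2 [x, y, z] [a, b, c] = succ x a (prec z b c)"
    "comp_component 2 2 2 F F 3 [x, y, z] [a, b, c] = succ x a (succ y b c)" for x y z a b c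
    by (simp_all add: comp_simps)
  have "{1..2 + 2 - 1} = {1, 2, 3 :: nat}"
    by auto
  then have "O_D_comp scale 2 2 1 F F = O_D_comp scale 2 2 2 F F \<longleftrightarrow>
    (\<forall>r \<in> {1, 2, 3}. \<forall>xs. length xs = 3 \<longrightarrow> (\<forall>as. length as = 3 \<longrightarrow>
       comp_component 2 2 1 F F r xs as = comp_component 2 2 2 F F r xs as))"
    unfolding O_D_comp_eq_iff[OF assms(1)] by auto
  then show ?thesis
    unfolding all3 by (simp add: left right left[unfolded One_nat_def] right[unfolded One_nat_def]) blast
qed

theorem theorem6p2:
  fixes scale :: "'k::comm_ring_1 \<Rightarrow> 'd::ab_group_add \<Rightarrow> 'd"
  assumes "CHAR('k) \<noteq> 2"
    and "module scale"
  shows "bij_betw (dendriform_family scale)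
           {(prec :: 'x \<Rightarrow> 'd \<Rightarrow> 'd \<Rightarrow> 'd, succ). matching_dendriform scale prec succ}
           {\<pi>. operad_multiplication (O_D scale) (O_D_comp scale) \<pi>}"
proof -
  have inj: "inj (dendriform_family scale ::
      ('x \<Rightarrow> 'd \<Rightarrow> 'd \<Rightarrow> 'd) \<times> ('x \<Rightarrow> 'd \<Rightarrow> 'd \<Rightarrow> 'd) \<Rightarrow> ('x, 'k, 'd) family)"
  proof (rule injI, clarify)
    fix prec succ prec' succ' :: "'x \<Rightarrow> 'd \<Rightarrow> 'd \<Rightarrow> 'd"
    assume "dendriform_family scale (prec, succ) = dendriform_family scale (prec', succ')"
    then show "prec = prec' \<and> succ = succ'"
      using component_dendriform_family[OF assms(2)] by (metis ext)
  qed
  have iff: "operad_multiplication (O_D scale) (O_D_comp scale) (dendriform_family scale (prec, succ))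
      \<longleftrightarrow> matching_dendriform scale prec succ"
    if "\<And>x. bilinear_op scale (prec x)" "\<And>x. bilinear_op scale (succ x)"
    for prec succ :: "'x \<Rightarrow> 'd \<Rightarrow> 'd \<Rightarrow> 'd"
    unfolding operad_multiplication_def matching_dendriform_def
      dendriform_family_associative_iff[OF assms(2)]
    using dendriform_family_in_O_D[of scale prec succ] assms(2) that by simp
  show ?thesis
  proof (rule bij_betw_imageI)
    show "inj_on (dendriform_family scale)
        {(prec :: 'x \<Rightarrow> 'd \<Rightarrow> 'd \<Rightarrow> 'd, succ). matching_dendriform scale prec succ}"
      using inj by (rule inj_on_subset) simp
    show "dendriform_family scale `
        {(prec :: 'x \<Rightarrow> 'd \<Rightarrow> 'd \<Rightarrow> 'd, succ). matching_dendriform scale prec succ} =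
        {\<pi>. operad_multiplication (O_D scale) (O_D_comp scale) \<pi>}" (is "_ ` ?A = ?B")
    proof (intro equalityI subsetI)
      fix \<pi> assume "\<pi> \<in> dendriform_family scale ` ?A"
      then obtain prec succ where "\<pi> = dendriform_family scale (prec, succ)"
        and m: "matching_dendriform scale prec succ"
        by auto
      moreover have "bilinear_op scale (prec x)" "bilinear_op scale (succ x)" for x
        using m by (simp_all add: matching_dendriform_def)
      ultimately show "\<pi> \<in> ?B"
        using iff by simp
    next
      fix \<pi> :: "('x, 'k, 'd) family" assume mult: "\<pi> \<in> ?B"
      then have "\<pi> \<in> O_D scale 2"
        by (simp add: operad_multiplication_def)
      then obtain prec succ where "\<And>x. bilinear_op scale (prec x)" "\<And>x. bilinear_op scale (succ x)"
        and \<pi>: "\<pi> = dendriform_family scale (prec, succ)"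
        using O_D_2_eq_dendriform_family[OF assms(2)] by blast
      then have "matching_dendriform scale prec succ"
        using mult iff by simp
      then show "\<pi> \<in> dendriform_family scale ` ?A"
        using \<pi> by blast
    qed
  qed
qed

end
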